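(* Let $q$ be a prime power such that $q\equiv 1\pmod 4$, and let $a,b\in\mathbb{F}_q^{\ast}$. Then the polynomial $$f(x)=b^3(x+a)^4-a\in\mathbb{F}_q[x]$$ is stable over $\mathbb{F}_q$ if and only if $ab$ is a non-square in $\mathbb{F}_q$.
   Context: For a field $K$, a polynomial $t(x)\in K[x]$ is called stable over $K$ if for every integer $n\ge 1$ the $n$-th iterate $t^{(n)}(x)=t(t(\cdots t(x)\cdots))$ ($n$-fold composition) is irreducible over $K$. *)

theory Defs
  imports "HOL-Computational_Algebra.Computational_Algebra" "HOL-Number_Theory.Cong"
    "HOL-Number_Theory.Prime_Powers"
    "HOL-Library.Cardinality"
begin

definition poly_iterate :: "nat \<Rightarrow> 'a::comm_semiring_1 poly \<Rightarrow> 'a poly" where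
  "poly_iterate n t = ((\<lambda>p. t \<circ>\<^sub>p p) ^^ n) [:0, 1:]"

definition stable_poly :: "'a::field poly \<Rightarrow> bool" where
  "stable_poly t \<longleftrightarrow> (\<forall>n\<ge>1. irreducible (poly_iterate n t))"

end

theory Submission
  imports Defs
begin

text \<open>
  With \<open>z = b (x + a)\<close> one has \<open>b (f(x) + a) = z\<^sup>4\<close>, hence
  the \<open>n\<close>-th iterate is \<open>(z\<^sup>N - ab) / b\<close> for \<open>N = 4\<^sup>n\<close>. If \<open>ab = c\<^sup>2\<close>, then \<open>b f = (z\<^sup>2 - c) (z\<^sup>2 + c)\<close> is
  reducible. Otherwise, let \<open>P\<close> be an irreducible factor of \<open>z\<^sup>N - ab\<close> of degree \<open>d < N\<close>.
  By Euler's criterion \<open>z\<close> to the power \<open>N (q - 1) / 2\<close> is \<open>-1\<close> modulo \<open>P\<close>, while by Fermat's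
  little theorem its power \<open>q\<^sup>d - 1\<close> is \<open>1\<close>. Since \<open>q \<equiv> 1 (mod 4)\<close>, the quotient
  \<open>(q\<^sup>d - 1) / (q - 1)\<close> is divisible by no higher power of 2 than \<open>d\<close>, so that \<open>q\<^sup>d - 1\<close>
  divides an odd multiple of \<open>N (q - 1) / 2\<close>, a contradiction.
\<close>

section \<open>The power of 2 in \<open>(q ^ d - 1) / (q - 1)\<close>\<close>

text \<open>The cofactor is the geometric sum \<open>1 + q + ... + q ^ (2 * m)\<close>, which has an
  odd number of odd terms; each induction step adds two terms.\<close>

lemma odd_power_eq_mult_pred:
  fixes q :: nat
  assumes "odd q"
  shows "\<exists>u. odd u \<and> q ^ (2 * m + 1) = (q - 1) * u + 1"
proof (induction m)
  case 0
  have "q = (q - 1) * 1 + 1" using assms by (cases q) auto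
  then show ?case by (intro exI[of _ 1]) simp
next
  case (Suc m)
  then obtain u where u: "odd u" "q ^ (2 * m + 1) = (q - 1) * u + 1" by blast
  have "q ^ (2 * Suc m + 1) = q ^ 2 * q ^ (2 * m + 1)"
    by (simp add: power_add power2_eq_square)
  also have "\<dots> = q ^ 2 * ((q - 1) * u + 1)" using u(2) by simp
  also have "\<dots> = (q - 1) * (q ^ 2 * u + q + 1) + 1"
    using assms by (cases q) (simp_all add: algebra_simps power2_eq_square)
  finally show ?case using u(1) assms by (intro exI[of _ "q ^ 2 * u + q + 1"]) auto
qed

text \<open>If \<open>q ^ e = A + 1\<close>, then \<open>q ^ (2 * e) - 1 = A * (A + 2)\<close>, and
  \<open>4 dvd A\<close> makes \<open>A + 2\<close> twice an odd number. So each halving of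
  \<open>d\<close> costs exactly one factor 2, until the exponent is odd.\<close>

lemma power_eq_mult_pred:
  fixes q :: nat
  assumes "q mod 4 = 1" "d > 0"
  shows "\<exists>j u. odd u \<and> 2 ^ j dvd d \<and> q ^ d = (q - 1) * 2 ^ j * u + 1"
  using assms(2)
proof (induction d rule: less_induct)
  case (less d)
  show ?case
  proof (cases "even d")
    case True
    then obtain e where e: "d = 2 * e" by blast
    with less obtain j u where ju: "odd u" "2 ^ j dvd e" "q ^ e = (q - 1) * 2 ^ j * u + 1"
      by (metis mult_2 less_add_same_cancel1 nat_0_less_mult_iff)
    define A where "A = (q - 1) * 2 ^ j * u"
    have "4 dvd q - 1" using assms(1) by presburger
    then have "4 dvd A" by (simp add: A_def)
    then obtain k where k: "A = 4 * k" by blast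
    have "q ^ d = (A + 1) ^ 2"
      unfolding e mult.commute[of 2 e] power_mult using ju(3) by (simp add: A_def)
    also have "\<dots> = A * 2 * (2 * k + 1) + 1"
      by (simp add: k algebra_simps power2_eq_square)
    also have "\<dots> = (q - 1) * 2 ^ Suc j * (u * (2 * k + 1)) + 1"
      by (simp add: A_def algebra_simps)
    finally show ?thesis using ju e
      by (intro exI[of _ "Suc j"] exI[of _ "u * (2 * k + 1)"]) auto
  next
    case False
    then obtain m where m: "d = 2 * m + 1" by (blast elim: oddE)
    have "odd q" using assms(1) by presburger
    from odd_power_eq_mult_pred[OF this, of m] obtain u
      where "odd u" "q ^ d = (q - 1) * u + 1" unfolding m by blast
    then show ?thesis by (intro exI[of _ 0] exI[of _ u]) simp
  qed
qed

section \<open>Fermat's little theorem modulo an irreducible polynomial\<close>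

text \<open>Bounding the support instead of the degree leaves exactly the zero polynomial at
  \<open>d = 0\<close>, where the induction starts; \<open>pCons\<close> then supplies one free
  coefficient per step.\<close>

lemma card_coeff_vanishing:
  "finite {p :: 'a::{comm_monoid_add,finite} poly. \<forall>i\<ge>d. coeff p i = 0} \<and>
   card {p :: 'a poly. \<forall>i\<ge>d. coeff p i = 0} = CARD('a) ^ d"
proof (induction d)
  case 0
  have "{p :: 'a poly. \<forall>i\<ge>0. coeff p i = 0} = {0}" by (auto simp: poly_eq_iff)
  then show ?case by simp
next
  case (Suc d)
  let ?R = "\<lambda>d. {p :: 'a poly. \<forall>i\<ge>d. coeff p i = 0}"
  have "?R (Suc d) = (\<lambda>(c, p). pCons c p) ` (UNIV \<times> ?R d)"
  proof (intro equalityI subsetI)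
    fix p assume p: "p \<in> ?R (Suc d)"
    obtain c r where "p = pCons c r" by (cases p)
    with p show "p \<in> (\<lambda>(c, p). pCons c p) ` (UNIV \<times> ?R d)"
      by (auto simp: image_iff coeff_pCons split: nat.splits)
  qed (auto simp: coeff_pCons split: nat.splits)
  moreover have "inj_on (\<lambda>(c, p). pCons c p) (UNIV \<times> ?R d)"
    by (auto simp: inj_on_def)
  ultimately show ?case using Suc
    by (simp add: card_image card_cartesian_product)
qed

lemma finite_degree_less:
  assumes "d > 0"
  shows "finite {p :: 'a::{comm_monoid_add,finite} poly. degree p < d}"
    and "card {p :: 'a poly. degree p < d} = CARD('a) ^ d"
proof -
  \<comment> \<open>The zero polynomial has degree 0 by convention, so it lies in the left-hand set
    because \<open>d > 0\<close>.\<close>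
  have "{p :: 'a poly. degree p < d} = {p. \<forall>i\<ge>d. coeff p i = 0}"
    using assms by (auto simp: coeff_eq_0) (metis leading_coeff_0_iff not_le degree_0)
  then show "finite {p :: 'a poly. degree p < d}" "card {p :: 'a poly. degree p < d} = CARD('a) ^ d"
    using card_coeff_vanishing[of d, where 'a='a] by simp_all
qed

lemma irreducible_imp_degree_pos:
  fixes P :: "'a::field poly"
  assumes "irreducible P"
  shows "degree P > 0"
  using assms is_unit_iff_degree[of P] by (auto simp: irreducible_def)

text \<open>Multiplication by \<open>z\<close> permutes the nonzero remainders modulo
  \<open>P\<close>. Comparing the product of all of them before and after, and cancelling it, leaves
  the power of \<open>z\<close>.\<close>

lemma irreducible_dvd_power_diff_1:
  fixes P z :: "'a::{field,finite} poly"
  assumes P: "irreducible P" and z: "\<not> P dvd z"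
  shows "P dvd z ^ (CARD('a) ^ degree P - 1) - 1"
proof -
  have d: "degree P > 0" using P by (rule irreducible_imp_degree_pos)
  have prime: "prime_elem P" using P by (rule field_poly_irreducible_imp_prime)
  define R where "R = {p :: 'a poly. degree p < degree P} - {0}"
  define h where "h = (\<lambda>r. (z * r) mod P)"
  have fin: "finite R" and card: "card R = CARD('a) ^ degree P - 1"
    using finite_degree_less[OF d, where 'a='a] d by (simp_all add: R_def card_Diff_singleton)
  have ndvd: "\<not> P dvd r" if "r \<in> R" for r
    using that by (auto simp: R_def dest: dvd_imp_degree_le)
  have "h ` R \<subseteq> R"
  proof safe
    fix r assume "r \<in> R"
    then have "\<not> P dvd z * r" using ndvd z prime by (simp add: prime_elem_dvd_mult_iff)
    then have "h r \<noteq> 0" by (simp add: h_def mod_eq_0_iff_dvd)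
    then show "h r \<in> R" using d by (auto simp: R_def h_def intro: degree_mod_less')
  qed
  moreover have "inj_on h R"
  proof (rule inj_onI)
    fix r s assume rs: "r \<in> R" "s \<in> R" "h r = h s"
    then have "P dvd z * r - z * s" by (simp add: h_def mod_eq_dvd_iff)
    then have "P dvd z * (r - s)" by (simp add: right_diff_distrib)
    then have "P dvd r - s" using prime z by (simp add: prime_elem_dvd_mult_iff)
    moreover have "degree (r - s) < degree P"
      using rs by (intro degree_diff_less) (auto simp: R_def)
    ultimately show "r = s" by (auto dest: dvd_imp_degree_le)
  qed
  ultimately have "h ` R = R" using fin by (simp add: endo_inj_surj)
  with \<open>inj_on h R\<close> have "\<Prod>R = (\<Prod>r\<in>R. h r)"
    using prod.reindex[of h R "\<lambda>x. x"] by simp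
  then have "(\<Prod>r\<in>R. z * r) mod P = \<Prod>R mod P"
    by (simp add: h_def mod_prod_eq)
  then have "P dvd z ^ card R * \<Prod>R - \<Prod>R"
    by (simp add: mod_eq_dvd_iff prod.distrib)
  then have "P dvd (z ^ card R - 1) * \<Prod>R" by (simp add: left_diff_distrib)
  moreover have "\<not> P dvd \<Prod>R"
    using fin ndvd
  proof (induction R rule: finite_induct)
    case empty
    show ?case using prime by (simp add: prime_elem_def)
  qed (use prime in \<open>simp add: prime_elem_dvd_mult_iff\<close>)
  ultimately show ?thesis using prime card by (simp add: prime_elem_dvd_mult_iff)
qed

lemma degree_diff_const:
  fixes p :: "'a::ab_group_add poly"
  assumes "degree p > 0"
  shows "degree (p - [:c:]) = degree p"
  using degree_add_eq_left[of "[:- c:]" p] assms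
  by (metis degree_pCons_0 diff_conv_add_uminus minus_pCons minus_zero)

lemma pcompose_power: "(p ^ n) \<circ>\<^sub>p q = (p \<circ>\<^sub>p q) ^ n"
  for p q :: "'a::comm_semiring_1 poly"
  by (induction n) (simp_all add: pcompose_mult pcompose_1)

section \<open>Euler's criterion in a finite field\<close>

text \<open>This is the preceding divisibility for a constant modulo the linear polynomial
  \<open>[:0, 1:]\<close>, which divides no nonzero constant.\<close>

lemma power_CARD_diff_1:
  fixes c :: "'a::{field,finite}"
  assumes "c \<noteq> 0"
  shows "c ^ (CARD('a) - 1) = 1"
proof -
  have "irreducible [:0, 1 :: 'a:]"
    by (rule irreducible_linear_field_poly) simp
  moreover have ndvd: "\<not> [:0, 1:] dvd [:e:]" if "e \<noteq> 0" for e :: 'a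
    using that by (auto simp: dvd_iff_poly_eq_0)
  ultimately have "[:0, 1:] dvd [:c:] ^ (CARD('a) - 1) - 1"
    using irreducible_dvd_power_diff_1[of "[:0, 1 :: 'a:]" "[:c:]"] assms by simp
  moreover have "[:c:] ^ (CARD('a) - 1) - 1 = [:c ^ (CARD('a) - 1) - 1:]"
    by (simp add: poly_const_pow one_pCons)
  ultimately show ?thesis using ndvd by fastforce
qed

text \<open>Squaring is at most two-to-one on the \<open>2 * m\<close> nonzero elements, so there
  are at least \<open>m\<close> nonzero squares. They all lie among the at most \<open>m\<close>
  roots of \<open>x ^ m - 1\<close>, hence exhaust them.\<close>

lemma is_square_if_power_eq_1:
  fixes c :: "'a::{field,finite}"
  assumes "odd CARD('a)" "c ^ ((CARD('a) - 1) div 2) = 1"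
  shows "is_square c"
proof -
  define m where "m = (CARD('a) - 1) div 2"
  \<comment> \<open>This gives \<open>m > 0\<close>, so that \<open>monom 1 m - 1\<close> is nonzero
    and the root bound applies.\<close>
  have "CARD('a) \<noteq> 1" using card_1_singletonE[of "UNIV :: 'a set"] 
    by (metis UNIV_I singletonD zero_neq_one)
  then have m: "m > 0" "CARD('a) - 1 = 2 * m" using assms(1) by (auto simp: m_def elim!: oddE)
  define T where "T = {x :: 'a. x ^ m = 1}"
  define S where "S = (\<lambda>x :: 'a. x ^ 2) ` (UNIV - {0})"
  have "T = {x. poly (monom 1 m - 1) x = 0}" by (auto simp: T_def poly_monom)
  moreover have "degree (monom 1 m - 1 :: 'a poly) = m"
    using m(1) degree_diff_const[of "monom 1 m :: 'a poly" 1]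
    by (simp add: degree_monom_eq one_pCons)
  moreover from this have "monom 1 m - 1 \<noteq> (0 :: 'a poly)" using m(1) by auto
  ultimately have T: "card T \<le> m" using card_poly_roots_bound by metis
  have "S \<subseteq> T"
    using power_CARD_diff_1[where 'a='a] m(2) by (auto simp: S_def T_def simp flip: power_mult)
  have "UNIV - {0} = (\<Union>s\<in>S. {x. x ^ 2 = s} - {0})" by (auto simp: S_def)
  then have "card (UNIV - {0 :: 'a}) \<le> (\<Sum>s\<in>S. card ({x. x ^ 2 = s} - {0}))"
    using card_UN_le[of S "\<lambda>s. {x. x ^ 2 = s} - {0}"] by simp
  also have "\<dots> \<le> (\<Sum>s\<in>S. 2)"
  proof (rule sum_mono)
    fix s assume "s \<in> S"
    then obtain y where "s = y ^ 2" by (auto simp: S_def)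
    then have "{x. x ^ 2 = s} - {0} \<subseteq> {y, - y}" by (auto simp: power2_eq_iff)
    then have "card ({x. x ^ 2 = s} - {0}) \<le> card {y, - y}" by (intro card_mono) auto
    also have "\<dots> \<le> 2" by (simp add: card_insert_if)
    finally show "card ({x. x ^ 2 = s} - {0}) \<le> 2" .
  qed
  finally have "card T \<le> card S" using m(2) T by (simp add: card_Diff_singleton)
  with \<open>S \<subseteq> T\<close> have "S = T" by (intro card_seteq) auto
  moreover have "c \<in> T" using assms(2) by (simp add: T_def m_def)
  ultimately show ?thesis by (auto simp: S_def)
qed

lemma euler_non_square:
  fixes c :: "'a::{field,finite}"
  assumes "odd CARD('a)" "\<not> is_square c"
  shows "c ^ ((CARD('a) - 1) div 2) = -1"
proof -
  have "c \<noteq> 0" using assms(2) by auto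
  then have "(c ^ ((CARD('a) - 1) div 2)) ^ 2 = 1"
    using power_CARD_diff_1[of c] assms(1) by (simp flip: power_mult)
  then show ?thesis using is_square_if_power_eq_1[OF assms(1)] assms(2)
    by (auto simp: power2_eq_1_iff)
qed

text \<open>In characteristic 2 the squaring map is injective, hence surjective.\<close>

lemma non_square_imp_minus_one_neq_one:
  fixes c :: "'a::{field,finite}"
  assumes "\<not> is_square c"
  shows "(-1 :: 'a) \<noteq> 1"
proof
  assume "(-1 :: 'a) = 1"
  then have "- x = x" for x :: 'a by (metis mult_minus1 mult_1)
  then have "inj (\<lambda>x :: 'a. x ^ 2)" by (auto simp: inj_def power2_eq_iff)
  then have "surj (\<lambda>x :: 'a. x ^ 2)" by (simp add: finite_UNIV_inj_surj)
  with assms show False by (metis is_nth_powerI surjD)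
qed

section \<open>Irreducible factors of \<open>z ^ 2 ^ k - [:c:]\<close>\<close>

lemma degree_irreducible_factor_ge:
  fixes P z :: "'a::{field,finite} poly"
  assumes q: "CARD('a) mod 4 = 1" and c: "\<not> is_square c"
    and P: "irreducible P" and dvd: "P dvd z ^ 2 ^ k - [:c:]"
  shows "degree P \<ge> 2 ^ k"
proof (rule ccontr)
  assume less: "\<not> degree P \<ge> 2 ^ k"
  have oddq: "odd CARD('a)" using q by presburger
  have d: "degree P > 0" using P by (rule irreducible_imp_degree_pos)
  have "c \<noteq> 0" using c by auto
  have ndvd: "\<not> P dvd [:e:]" if "e \<noteq> 0" for e
    using d that by (auto dest: dvd_imp_degree_le)
  have "\<not> P dvd z"
  proof
    assume "P dvd z"
    then have "P dvd z ^ 2 ^ k" by (simp add: dvd_trans[OF _ dvd_power])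
    with dvd have "P dvd [:c:]" using dvd_diff_right_iff by blast
    with ndvd \<open>c \<noteq> 0\<close> show False by blast
  qed
  obtain j u where ju: "odd u" "2 ^ j dvd degree P"
      "CARD('a) ^ degree P = (CARD('a) - 1) * 2 ^ j * u + 1"
    using power_eq_mult_pred[OF q d] by blast
  \<comment> \<open>The strict inequality \<open>j < k\<close> leaves a spare factor 2 in
    \<open>2 ^ k\<close>, which turns \<open>m\<close> back into \<open>CARD('a) - 1\<close>;
    \<open>2 ^ i\<close> is what remains.\<close>
  have "(2::nat) ^ j < 2 ^ k" using less d ju(2) by (meson dvd_imp_le le_less_trans not_le)
  then have "j < k" by simp
  then obtain i where i: "k = Suc (j + i)" by (auto simp: less_iff_Suc_add)
  define m where "m = (CARD('a) - 1) div 2"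
  have m: "CARD('a) - 1 = 2 * m" using oddq by (simp add: m_def)
  have exp: "2 ^ k * (m * u) = (CARD('a) ^ degree P - 1) * 2 ^ i"
    using m by (simp add: ju(3) i power_add mult_ac)
  have "z ^ (CARD('a) ^ degree P - 1) mod P = 1 mod P"
    using irreducible_dvd_power_diff_1[OF P \<open>\<not> P dvd z\<close>] by (simp add: mod_eq_dvd_iff)
  then have "z ^ (2 ^ k * (m * u)) mod P = 1 mod P"
    unfolding exp power_mult by (metis power_mod power_one)
  \<comment> \<open>The same power again, now through \<open>c ^ m = -1\<close>; the sign survives
    because \<open>u\<close> is odd.\<close>
  moreover have "z ^ (2 ^ k * (m * u)) mod P = [:-1:] mod P"
  proof -
    have "z ^ 2 ^ k mod P = [:c:] mod P" using dvd by (simp add: mod_eq_dvd_iff)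
    then have "z ^ (2 ^ k * (m * u)) mod P = [:c:] ^ (m * u) mod P"
      unfolding power_mult[of _ "2 ^ k"] by (metis power_mod)
    also have "[:c:] ^ (m * u) = [:-1:]"
      using euler_non_square[OF oddq c] ju(1) by (simp add: poly_const_pow power_mult m_def)
    finally show ?thesis .
  qed
  ultimately have "P dvd 1 - [:-1:]" by (metis mod_eq_dvd_iff)
  also have "1 - [:-1:] = [:1 - (-1 :: 'a):]" by (simp add: one_pCons)
  finally show False using ndvd non_square_imp_minus_one_neq_one[OF c] by (metis eq_iff_diff_eq_0)
qed

lemma exists_irreducible_factor:
  fixes p :: "'a::field poly"
  assumes "degree p > 0"
  shows "\<exists>P. irreducible P \<and> P dvd p"
  using assms
proof (induction "degree p" arbitrary: p rule: less_induct)
  case less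
  show ?case
  proof (cases "irreducible p")
    case False
    have "p \<noteq> 0" using less.prems by auto
    moreover from this have "\<not> p dvd 1" using less.prems by (simp add: is_unit_iff_degree)
    ultimately obtain u v where uv: "p = u * v" "\<not> u dvd 1" "\<not> v dvd 1"
      using False by (auto simp: irreducible_def)
    then have "degree u > 0" "degree u < degree p"
      using \<open>p \<noteq> 0\<close> by (auto simp: is_unit_iff_degree degree_mult_eq)
    with less.hyps uv(1) show ?thesis by (meson dvd_mult2)
  qed auto
qed

text \<open>A proper factorization would contain an irreducible factor of degree below
  \<open>2 ^ k\<close>. A divisor \<open>F\<close> of full degree is considered because an iterate
  agrees with the power difference only up to a scalar.\<close>

lemma irreducible_power_diff_const:
  fixes F z :: "'a::{field,finite} poly"
  assumes "CARD('a) mod 4 = 1" "\<not> is_square c"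
    and deg: "degree F = 2 ^ k" and dvd: "F dvd z ^ 2 ^ k - [:c:]"
  shows "irreducible F"
proof (rule irreducibleI)
  show "F \<noteq> 0" using deg by auto
  then show "\<not> F dvd 1" using deg by (simp add: is_unit_iff_degree)
  fix u v assume uv: "F = u * v"
  show "u dvd 1 \<or> v dvd 1"
  proof (rule ccontr)
    assume "\<not> (u dvd 1 \<or> v dvd 1)"
    with uv \<open>F \<noteq> 0\<close> have pos: "degree u > 0" "degree u < degree F"
      by (auto simp: is_unit_iff_degree degree_mult_eq)
    then obtain P where P: "irreducible P" "P dvd u" using exists_irreducible_factor by blast
    then have "P dvd z ^ 2 ^ k - [:c:]" using uv dvd by (meson dvd_mult2 dvd_trans)
    then have "2 ^ k \<le> degree P" using assms P by (intro degree_irreducible_factor_ge) auto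
    moreover have "degree P \<le> degree u" using P pos by (intro dvd_imp_degree_le) auto
    ultimately show False using pos deg by simp
  qed
qed

section \<open>The iterates of \<open>f\<close> and their irreducibility\<close>

lemma poly_iterate_conj:
  fixes a b :: "'a::field"
  defines "f \<equiv> smult (b ^ 3) ([:a, 1:] ^ 4) - [:a:]"
  shows "smult b (poly_iterate n f) = [:a * b, b:] ^ 4 ^ n - [:a * b:]"
proof (induction n)
  case 0
  show ?case by (simp add: poly_iterate_def mult.commute)
next
  case (Suc n)
  define p where "p = poly_iterate n f"
  have "smult b (poly_iterate (Suc n) f) = smult b (f \<circ>\<^sub>p p)"
    by (simp add: poly_iterate_def p_def)
  also have "f \<circ>\<^sub>p p = smult (b ^ 3) (([:a:] + p) ^ 4) - [:a:]"
    by (simp add: f_def pcompose_diff pcompose_smult pcompose_pCons pcompose_power)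
  \<comment> \<open>The outer factor \<open>b\<close> completes \<open>b ^ 3\<close> to
    \<open>b ^ 4\<close>, which moves inside the fourth power.\<close>
  also have "smult b \<dots> = (smult b p + [:a * b:]) ^ 4 - [:a * b:]"
  proof -
    have "smult b p + [:a * b:] = smult b ([:a:] + p)" by (simp add: smult_add_right mult.commute)
    then show ?thesis
      by (simp add: smult_diff_right smult_power power_Suc[symmetric] mult.commute del: power_Suc)
  qed
  also have "smult b p + [:a * b:] = [:a * b, b:] ^ 4 ^ n" using Suc by (simp add: p_def)
  finally show ?case by (simp add: power_mult[symmetric] mult.commute)
qed

theorem theorem5p3:
  fixes q :: nat and a b :: "'a::{field, finite}"
  assumes "primepow q" and "CARD('a) = q"
    and "[q = 1] (mod 4)"
    and "a \<noteq> 0" and "b \<noteq> 0"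
  shows "stable_poly (smult (b ^ 3) ([:a, 1:] ^ 4) - [:a:]) \<longleftrightarrow> \<not> is_square (a * b)"
proof
  let ?f = "smult (b ^ 3) ([:a, 1:] ^ 4) - [:a:]" and ?z = "[:a * b, b:]"
  {
    assume stable: "stable_poly ?f"
    show "\<not> is_square (a * b)"
    proof
      assume "is_square (a * b)"
      then obtain c where c: "a * b = c ^ 2" by (auto elim: is_nth_powerE)
      have irr: "irreducible (poly_iterate 1 ?f)" using stable by (simp add: stable_poly_def)
      define u where "u = ?z ^ 2 - [:c:]"
      define v where "v = ?z ^ 2 + [:c:]"
      have "smult b (poly_iterate 1 ?f) = ?z ^ 4 - [:a * b:]"
        using poly_iterate_conj[of b 1 a] by simp
      also have "?z ^ 4 - [:a * b:] = u * v"
        unfolding c u_def v_def by (simp add: algebra_simps power2_eq_square eval_nat_numeral)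
      \<comment> \<open>Dividing by \<open>b\<close> turns the difference of squares into a
        factorization of the iterate itself; both factors have degree 2 and so are not
        units.\<close>
      finally have "smult (inverse b) (smult b (poly_iterate 1 ?f)) = smult (inverse b) u * v"
        by simp
      then have "poly_iterate 1 ?f = smult (inverse b) u * v" using \<open>b \<noteq> 0\<close> by simp
      with irr have "smult (inverse b) u dvd 1 \<or> v dvd 1" by (rule irreducibleD)
      moreover have "degree u = 2" "degree v = 2"
        using \<open>b \<noteq> 0\<close> by (auto simp: u_def v_def power2_eq_square)
      moreover from this have "u \<noteq> 0" "v \<noteq> 0" by auto
      ultimately show False using \<open>b \<noteq> 0\<close>
        by (auto simp: is_unit_iff_degree)
    qed
  }
  {
    assume ns: "\<not> is_square (a * b)"
    have q: "CARD('a) mod 4 = 1" using assms by (simp add: cong_def)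
    show "stable_poly ?f" unfolding stable_poly_def
    proof safe
      fix n :: nat
      let ?F = "poly_iterate n ?f"
      \<comment> \<open>Writing \<open>4 ^ n\<close> as \<open>2 ^ (2 * n)\<close> gives the
        power-of-two exponent with \<open>k = 2 * n\<close>.\<close>
      have eq: "smult b ?F = ?z ^ 2 ^ (2 * n) - [:a * b:]"
        by (simp add: poly_iterate_conj power_mult)
      have "degree ?F = degree (smult b ?F)" using \<open>b \<noteq> 0\<close> by simp
      also have "\<dots> = degree (?z ^ 2 ^ (2 * n))"
        unfolding eq using \<open>b \<noteq> 0\<close> by (intro degree_diff_const) (simp add: degree_power_eq)
      also have "\<dots> = 2 ^ (2 * n)" using \<open>b \<noteq> 0\<close> by (simp add: degree_power_eq)
      finally have "degree ?F = 2 ^ (2 * n)" .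
      moreover have "?F dvd ?z ^ 2 ^ (2 * n) - [:a * b:]"
        unfolding eq[symmetric] by (simp add: dvd_smult)
      ultimately show "irreducible ?F" using irreducible_power_diff_const[OF q ns] by blast
    qed
  }
qed

end
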